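(* Let $n\ge 2$, let $F=q\circ A\circ\ell$ where $A\in\mathbb{R}^{(n+1)\times(n+1)}$ is an invertible matrix, and let $M\in\mathbb{R}^{(n+1)\times(n+1)}$ be an indefinite symmetric matrix such that $\mathrm{rank}(M)>2$. The quadric $\mathcal{Q}(M)$ is $F$-invariant if and only if $A^TMA=\mu M$ for some non-zero $\mu\in\mathbb{R}$.
   Context: Define $q(a_1,\dots,a_{n+1})=(a_1/a_{n+1},\dots,a_n/a_{n+1})$ for $(a_1,\dots,a_{n+1})\in\mathbb{R}^{n+1}$ with $a_{n+1}\neq 0$, and $\ell:\mathbb{R}^n\to\mathbb{R}^{n+1}$, $\ell(a_1,\dots,a_n)=(a_1,\dots,a_n,1)^T$. Let $\mathrm{pr}:\mathbb{R}^{n+1}\to\mathbb{R}$ be the projection on the last, $(n+1)$-th, component. The map $F=q\circ A\circ\ell$, $F(X)=q(A\ell(X))$, is defined on $\mathbb{R}^n\setminus\mathcal{PF}$, where $\mathcal{PF}=\{X\in\mathbb{R}^n : \mathrm{pr}(A\ell(X))=0\}$. A subset $\mathcal{S}\subset\mathbb{R}^n$ is $F$-invariant if $F(\mathcal{S}\setminus\mathcal{PF})\subset\mathcal{S}$. For a symmetric matrix $M\in\mathbb{R}^{(n+1)\times(n+1)}$, $\mathcal{Q}(M)=\{X\in\mathbb{R}^n : \ell(X)^TM\ell(X)=0\}$. A symmetric matrix is indefinite if its quadratic form takes both positive and negative values. *)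

theory Defs
  imports "HOL-Analysis.Analysis"
begin

text \<open>
  \<open>\<real>\<^sup>n\<close> is \<^typ>\<open>real ^ 'n\<close> with \<open>n = CARD('n)\<close>, and \<open>\<real>\<^sup>n\<^sup>+\<^sup>1\<close> is
  \<^typ>\<open>real ^ 'n option\<close>, since \<open>CARD('n option) = CARD('n) + 1\<close>. Index \<^term>\<open>Some i\<close>
  is the component \<open>i\<close> of \<open>\<real>\<^sup>n\<close>, and \<^term>\<open>None\<close> is the additional last component.
\<close>

definition proj_last :: "real ^ 'n::finite option \<Rightarrow> real" where
  "proj_last a = a $ None"

definition lift :: "real ^ 'n::finite \<Rightarrow> real ^ 'n option" where
  "lift X = (\<chi> j. case j of Some i \<Rightarrow> X $ i | None \<Rightarrow> 1)"

text \<open>Meaningful only for \<^term>\<open>a\<close> with non-zero last component.\<close>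

definition dehomog :: "real ^ 'n::finite option \<Rightarrow> real ^ 'n" where
  "dehomog a = (\<chi> i. a $ Some i / a $ None)"

text \<open>
  The linear fractional map \<open>F\<close> of \<open>A\<close> is total here; its mathematical domain is the
  complement of the forbidden set below.
\<close>

definition linfrac :: "real ^ 'n::finite option ^ 'n option \<Rightarrow> real ^ 'n \<Rightarrow> real ^ 'n" where
  "linfrac A X = dehomog (A *v lift X)"

definition forbidden :: "real ^ 'n::finite option ^ 'n option \<Rightarrow> (real ^ 'n) set" where
  "forbidden A = {X. proj_last (A *v lift X) = 0}"

definition linfrac_invariant ::
  "real ^ 'n::finite option ^ 'n option \<Rightarrow> (real ^ 'n) set \<Rightarrow> bool" where
  "linfrac_invariant A S \<longleftrightarrow> linfrac A ` (S - forbidden A) \<subseteq> S"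

definition quadric :: "real ^ 'n::finite option ^ 'n option \<Rightarrow> (real ^ 'n) set" where
  "quadric M = {X. lift X \<bullet> (M *v lift X) = 0}"

definition symmetric_matrix :: "real ^ 'k::finite ^ 'k \<Rightarrow> bool" where
  "symmetric_matrix M \<longleftrightarrow> transpose M = M"

definition indefinite :: "real ^ 'k::finite ^ 'k \<Rightarrow> bool" where
  "indefinite M \<longleftrightarrow> (\<exists>x. x \<bullet> (M *v x) > 0) \<and> (\<exists>x. x \<bullet> (M *v x) < 0)"

end

theory Submission
  imports Defs "HOL-Library.Quadratic_Discriminant"
begin

text \<open>
  Write \<open>B\<close> and \<open>C\<close> for the quadratic forms of \<open>M\<close> and of \<open>A\<^sup>T M A\<close>. Invariance says that \<open>C\<close>
  vanishes at the zeros of \<open>B\<close> lying outside two hyperplanes \<open>p = 0\<close> (infinity) and \<open>q = 0\<close>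
  (the forbidden set). If \<open>B u > 0 > B w\<close>, the line through \<open>u\<close> and \<open>w\<close> carries two zeros of \<open>B\<close>;
  if both avoid the hyperplanes, then \<open>C u * B w = C w * B u\<close>. A zero on this line meets the
  hyperplane \<open>p = 0\<close> only if \<open>B (p w u - p u w) = 0\<close>, and this polynomial in \<open>(u, w)\<close> vanishes
  identically only if \<open>B\<close> vanishes on a hyperplane, which forces \<open>rank M \<le> 2\<close>. As a product of
  non-zero polynomials does not vanish on a non-empty open set, \<open>C u * B w = C w * B u\<close> holds
  for all \<open>u\<close> and \<open>w\<close>, so \<open>C\<close> is a multiple of \<open>B\<close>.
\<close>

text \<open>On the line from a point of \<open>S\<close> to \<open>a\<close>, \<open>f\<close> is a
  univariate polynomial that is non-zero at parameter 1, so it has finitely many roots. The part of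
  the line in the open set \<open>S\<close> has infinitely many parameters.\<close>

lemma real_polynomial_function_nonzero_in_open:
  fixes f :: "'a::euclidean_space \<Rightarrow> real"
  assumes f: "real_polynomial_function f" and a: "f a \<noteq> 0" and S: "open S" "S \<noteq> {}"
  shows "\<exists>x\<in>S. f x \<noteq> 0"
proof (rule ccontr)
  assume "\<not> (\<exists>x\<in>S. f x \<noteq> 0)"
  then have zero: "f x = 0" if "x \<in> S" for x
    using that by blast
  obtain x where x: "x \<in> S"
    using S by blast
  define l where "l s = x + s *\<^sub>R (a - x)" for s :: real
  have "polynomial_function l"
    unfolding l_def
    by (intro polynomial_function_add polynomial_function_mult polynomial_function_const)
      (simp_all add: polynomial_function_id)
  from real_polynomial_function_compose[OF this f]
  have "real_polynomial_function (f \<circ> l)" .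
  then obtain c n where c: "f \<circ> l = (\<lambda>s. \<Sum>i\<le>n. c i * s ^ i)"
    by (auto simp: real_polynomial_function_iff_sum)
  have "(\<Sum>i\<le>n. c i * 1 ^ i) \<noteq> 0"
    using a fun_cong[OF c, of 1] by (simp add: l_def)
  then obtain k where "k \<le> n" "c k \<noteq> 0"
    by (metis (no_types, lifting) atMost_iff mult_zero_left sum.neutral)
  then have "finite {s. (\<Sum>i\<le>n. c i * s ^ i) = 0}"
    by (metis polyfun_finite_roots)
  then have fin: "finite {s. f (l s) = 0}"
    using c by (metis (mono_tags, lifting) Collect_cong comp_def)
  have "open (l -` S)"
    using S(1) by (rule open_vimage) (auto simp: l_def intro!: continuous_intros)
  moreover have "0 \<in> l -` S"
    using x by (simp add: l_def)
  ultimately have "infinite (l -` S)"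
    by (metis infinite_openin open_openin emptyE islimpt_UNIV finite_imp_not_open)
  moreover have "l -` S \<subseteq> {s. f (l s) = 0}"
    using zero by auto
  ultimately show False
    using fin finite_subset by blast
qed

section \<open>Quadratic forms of matrices\<close>

definition qform :: "real ^ 'k::finite ^ 'k \<Rightarrow> real ^ 'k \<Rightarrow> real" where
  "qform M x = x \<bullet> (M *v x)"

lemma qform_scaleR: "qform M (c *\<^sub>R x) = c\<^sup>2 * qform M x"
  by (simp add: qform_def matrix_vector_mult_scaleR power2_eq_square)

lemma qform_add_scaleR:
  "qform M (u + t *\<^sub>R w) = qform M u + t * (u \<bullet> (M *v w) + w \<bullet> (M *v u)) + t\<^sup>2 * qform M w"
  by (simp add: qform_def matrix_vector_right_distrib matrix_vector_mult_scaleR inner_add_left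
      inner_add_right power2_eq_square algebra_simps)

lemma symmetric_matrix_inner:
  assumes "symmetric_matrix M"
  shows "x \<bullet> (M *v y) = y \<bullet> (M *v x)"
  using assms by (metis dot_lmul_matrix inner_commute symmetric_matrix_def transpose_matrix_vector)

lemma qform_congruence: "qform (transpose A ** M ** A) x = qform M (A *v x)"
  by (simp add: qform_def matrix_vector_mul_assoc[symmetric] transpose_matrix_vector)
    (metis dot_lmul_matrix inner_commute)

text \<open>Polarization: expanding the form at \<open>x + y\<close> recovers the symmetric bilinear
  form.\<close>

lemma symmetric_matrix_eqI:
  assumes "symmetric_matrix M" "symmetric_matrix N" and eq: "\<And>x. qform M x = qform N x"
  shows "M = N"
proof -
  have "x \<bullet> (M *v y) = x \<bullet> (N *v y)" for x y
    using qform_add_scaleR[of M x 1 y] qform_add_scaleR[of N x 1 y] eq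
      symmetric_matrix_inner[OF assms(1), of x y] symmetric_matrix_inner[OF assms(2), of x y]
    by simp
  then have "M *v y = N *v y" for y
    by (metis vector_eq_ldot)
  then show ?thesis
    by (simp add: matrix_eq)
qed

text \<open>By polarization the bilinear form vanishes on the hyperplane orthogonal to
  \<open>e\<close>, so \<open>M\<close> maps this hyperplane into the line spanned by
  \<open>e\<close>. Only the image of \<open>e\<close> itself can add a second dimension to the
  range.\<close>

lemma rank_le_2_if_qform_zero_on_hyperplane:
  fixes M :: "real ^ 'k::finite ^ 'k"
  assumes M: "symmetric_matrix M" and zero: "\<And>x. e \<bullet> x = 0 \<Longrightarrow> qform M x = 0"
    and e: "e \<noteq> 0"
  shows "rank M \<le> 2"
proof -
  have bil: "x \<bullet> (M *v y) = 0" if "e \<bullet> x = 0" "e \<bullet> y = 0" for x y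
    using qform_add_scaleR[of M x 1 y] that zero[of x] zero[of y] zero[of "x + y"]
      symmetric_matrix_inner[OF M, of x y] by (simp add: inner_add_right)
  have "M *v x \<in> span {e, M *v e}" for x
  proof -
    define y where "y = x - (e \<bullet> x / (e \<bullet> e)) *\<^sub>R e"
    have y: "e \<bullet> y = 0"
      using e by (simp add: y_def inner_diff_right)
    \<comment> \<open>\<open>z\<close> is the part of \<open>M *v y\<close> orthogonal to
      \<open>e\<close>; it equals 0 because
      \<open>z \<bullet> z = z \<bullet> (M *v y)\<close>.\<close>
    define z where "z = M *v y - (e \<bullet> (M *v y) / (e \<bullet> e)) *\<^sub>R e"
    have z: "e \<bullet> z = 0"
      using e by (simp add: z_def inner_diff_right)
    then have "z \<bullet> z = 0"
      using bil[OF z y] by (simp add: z_def inner_diff_right inner_commute)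
    then have "M *v y = (e \<bullet> (M *v y) / (e \<bullet> e)) *\<^sub>R e"
      by (simp add: z_def)
    then have "M *v x = (e \<bullet> (M *v y) / (e \<bullet> e)) *\<^sub>R e + (e \<bullet> x / (e \<bullet> e)) *\<^sub>R (M *v e)"
      by (simp add: y_def matrix_vector_mult_diff_distrib matrix_vector_mult_scaleR algebra_simps)
    then show ?thesis
      by (metis span_add span_base span_scale insertI1 insertI2)
  qed
  then have "range ((*v) M) \<subseteq> span {e, M *v e}"
    by blast
  then have "rank M \<le> card {e, M *v e}"
    by (simp add: rank_dim_range dim_le_card)
  also have "\<dots> \<le> 2"
    by (simp add: card_insert_if)
  finally show ?thesis .
qed

section \<open>Proportionality of two quadratic forms\<close>

lemma real_polynomial_function_qform:
  fixes f :: "'a::euclidean_space \<Rightarrow> real ^ 'k::finite"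
  assumes f: "\<And>i. real_polynomial_function (\<lambda>x. f x $ i)"
  shows "real_polynomial_function (\<lambda>x. qform M (f x))"
  unfolding qform_def inner_vec_def matrix_vector_mult_def
  by (auto intro!: f real_polynomial_function_sum real_polynomial_function.intros(2-4))

lemma qform_proportional:
  fixes M N :: "real ^ 'k::finite ^ 'k"
  assumes M: "symmetric_matrix M" "indefinite M" "rank M > 2"
    and e: "e \<noteq> 0" and d: "d \<noteq> 0"
    and zero: "\<And>v. qform M v = 0 \<Longrightarrow> e \<bullet> v \<noteq> 0 \<Longrightarrow> d \<bullet> v \<noteq> 0 \<Longrightarrow> qform N v = 0"
  shows "\<exists>\<mu>. \<forall>x. qform N x = \<mu> * qform M x"
proof -
  \<comment> \<open>The vector inside \<open>qform\<close> lies on the hyperplane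
    \<open>a \<bullet> v = 0\<close> and in the span of the pair; avoiding division keeps
    \<open>g a\<close> polynomial.\<close>
  define g where "g a z = qform M ((a \<bullet> snd z) *\<^sub>R fst z - (a \<bullet> fst z) *\<^sub>R snd z)"
    for a :: "real ^ 'k" and z :: "(real ^ 'k) \<times> (real ^ 'k)"
  define h where "h z = qform N (fst z) * qform M (snd z) - qform N (snd z) * qform M (fst z)"
    for z :: "(real ^ 'k) \<times> (real ^ 'k)"
  have lin: "real_polynomial_function (\<lambda>z::(real ^ 'k) \<times> (real ^ 'k). fst z $ i)"
    "real_polynomial_function (\<lambda>z::(real ^ 'k) \<times> (real ^ 'k). snd z $ i)" for i
    by (auto intro!: real_polynomial_function.intros(1) bounded_linear_intros
        bounded_linear_compose[OF bounded_linear_vec_nth])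
  have pg: "real_polynomial_function (g a)" for a
    unfolding g_def
    by (rule real_polynomial_function_qform)
      (auto simp: inner_vec_def intro!: lin real_polynomial_function_sum
        real_polynomial_function_diff real_polynomial_function.intros(2-4))
  have ph: "real_polynomial_function h"
    unfolding h_def
    by (intro real_polynomial_function_diff real_polynomial_function.intros(2-4)
        real_polynomial_function_qform lin)
  have pM: "real_polynomial_function (\<lambda>z::(real ^ 'k) \<times> (real ^ 'k). qform M (fst z))"
    "real_polynomial_function (\<lambda>z::(real ^ 'k) \<times> (real ^ 'k). qform M (snd z))"
    by (intro real_polynomial_function_qform lin)+
  have cont: "continuous_on UNIV f" if "real_polynomial_function f"
    for f :: "(real ^ 'k) \<times> (real ^ 'k) \<Rightarrow> real"
    using that by (simp add: continuous_on_polymonial_function real_polynomial_function_eq)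
  have g_nz: "\<exists>z. g a z \<noteq> 0" if a: "a \<noteq> 0" for a
  proof -
    obtain x where x: "a \<bullet> x = 0" "qform M x \<noteq> 0"
      using rank_le_2_if_qform_zero_on_hyperplane[OF M(1) _ a] M(3) by force
    \<comment> \<open>At the pair \<open>(a, x)\<close> the first coefficient vanishes, leaving a
      multiple of \<open>x\<close>.\<close>
    then have "g a (a, x) = (- (a \<bullet> a))\<^sup>2 * qform M x"
      unfolding g_def using qform_scaleR[of M "- (a \<bullet> a)" x] by simp
    then show ?thesis
      using x a by (metis inner_eq_zero_iff mult_eq_0_iff neg_equal_0_iff_equal power2_eq_square)
  qed
  have h_zero: "h (u, w) = 0"
    if uw: "qform M u > 0" "qform M w < 0" and ge: "g e (u, w) \<noteq> 0" and gd: "g d (u, w) \<noteq> 0"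
    for u w
  proof -
    define b where "b = u \<bullet> (M *v w) + w \<bullet> (M *v u)"
    define c where "c = u \<bullet> (N *v w) + w \<bullet> (N *v u)"
    \<comment> \<open>If a zero \<open>u + t *\<^sub>R w\<close> lay on the hyperplane of
      \<open>a\<close>, the vector in \<open>g a (u, w)\<close> would be a multiple of it, making
      \<open>g a (u, w)\<close> zero.\<close>
    have off: "a \<bullet> (u + t *\<^sub>R w) \<noteq> 0"
      if "qform M (u + t *\<^sub>R w) = 0" "g a (u, w) \<noteq> 0" for a t
    proof
      assume "a \<bullet> (u + t *\<^sub>R w) = 0"
      then have "a \<bullet> u = - t * (a \<bullet> w)"
        by (simp add: inner_add_right)
      then have "g a (u, w) = qform M ((a \<bullet> w) *\<^sub>R (u + t *\<^sub>R w))"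
        by (simp add: g_def algebra_simps)
      then show False
        using that by (simp add: qform_scaleR)
    qed
    have N0: "qform N u + t * c + t\<^sup>2 * qform N w = 0"
      if "qform M w * t\<^sup>2 + b * t + qform M u = 0" for t
    proof -
      have "qform M (u + t *\<^sub>R w) = 0"
        using that by (simp add: qform_add_scaleR b_def algebra_simps)
      then have "qform N (u + t *\<^sub>R w) = 0"
        using zero off ge gd by blast
      then show ?thesis
        by (simp add: qform_add_scaleR c_def)
    qed
    have "discrim (qform M w) b (qform M u) > 0"
    proof -
      have "qform M w * qform M u < 0"
        using uw by (simp add: mult_neg_pos)
      then show ?thesis
        unfolding discrim_def using zero_le_power2[of b] by linarith
    qed
    then obtain s t where st: "s \<noteq> t" "qform M w * s\<^sup>2 + b * s + qform M u = 0"
      "qform M w * t\<^sup>2 + b * t + qform M u = 0"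
      using discriminant_pos_ex[of "qform M w" b "qform M u"] uw by fastforce
    \<comment> \<open>Eliminating \<open>y\<close> from the two equations avoids dividing by
      \<open>x\<close>, which may be 0 when \<open>x\<close> is \<open>qform N w\<close>.\<close>
    have vieta: "z = s * t * x" if "x * s\<^sup>2 + y * s + z = 0" "x * t\<^sup>2 + y * t + z = 0"
      for x y z :: real
    proof -
      have "(s - t) * (z - s * t * x) = s * (x * t\<^sup>2 + y * t + z) - t * (x * s\<^sup>2 + y * s + z)"
        by (simp add: algebra_simps power2_eq_square)
      then show ?thesis
        using that st(1) by simp
    qed
    have "qform M u = s * t * qform M w"
      using vieta st by blast
    moreover have "qform N u = s * t * qform N w"
      using vieta[of "qform N w" c "qform N u"] N0[OF st(2)] N0[OF st(3)]
      by (simp add: algebra_simps)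
    ultimately show ?thesis
      by (simp add: h_def)
  qed
  define S where "S = {z. qform M (fst z) > 0} \<inter> {z. qform M (snd z) < 0}"
  have nz_open: "open {z. f z \<noteq> 0}" if "real_polynomial_function f"
    for f :: "(real ^ 'k) \<times> (real ^ 'k) \<Rightarrow> real"
    using cont[OF that] by (intro open_Collect_neq) (auto intro: continuous_intros)
  have S: "open S"
    unfolding S_def using cont[OF pM(1)] cont[OF pM(2)]
    by (intro open_Int open_Collect_less) (auto intro: continuous_intros)
  obtain u w where uw: "qform M u > 0" "qform M w < 0"
    using M(2) by (auto simp: indefinite_def qform_def)
  then have "(u, w) \<in> S"
    by (simp add: S_def)
  then have "S \<noteq> {}"
    by blast
  \<comment> \<open>The open set \<open>S\<close> is cut down by one polynomial at a time and stays
    open and non-empty, so a non-zero \<open>h\<close> would be non-zero somewhere on what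
    remains.\<close>
  then have e_ne: "S \<inter> {z. g e z \<noteq> 0} \<noteq> {}"
    using real_polynomial_function_nonzero_in_open[OF pg _ S] g_nz[OF e] by blast
  have e_op: "open (S \<inter> {z. g e z \<noteq> 0})"
    using S nz_open[OF pg] by (rule open_Int)
  have d_ne: "S \<inter> {z. g e z \<noteq> 0} \<inter> {z. g d z \<noteq> 0} \<noteq> {}"
    using real_polynomial_function_nonzero_in_open[OF pg _ e_op e_ne] g_nz[OF d] by blast
  have d_op: "open (S \<inter> {z. g e z \<noteq> 0} \<inter> {z. g d z \<noteq> 0})"
    using e_op nz_open[OF pg] by (rule open_Int)
  have h0: "h z = 0" for z
    using real_polynomial_function_nonzero_in_open[OF ph _ d_op d_ne] h_zero
    by (fastforce simp: S_def)
  have "qform N x = qform N u / qform M u * qform M x" for x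
    using h0[of "(u, x)"] uw(1) by (simp add: h_def field_simps)
  then show ?thesis
    by blast
qed

section \<open>From affine points to homogeneous coordinates\<close>

lemma lift_dehomog: "a $ None \<noteq> 0 \<Longrightarrow> lift (dehomog a) = (1 / a $ None) *\<^sub>R a"
  by (auto simp: vec_eq_iff lift_def dehomog_def split: option.split)

lemma lift_None [simp]: "lift X $ None = 1"
  by (simp add: lift_def)

lemma mem_quadric_iff: "X \<in> quadric M \<longleftrightarrow> qform M (lift X) = 0"
  by (simp add: quadric_def qform_def)

lemma dehomog_mem_quadric_iff: "a $ None \<noteq> 0 \<Longrightarrow> dehomog a \<in> quadric M \<longleftrightarrow> qform M a = 0"
  by (simp add: mem_quadric_iff lift_dehomog qform_scaleR)

text \<open>A vector with non-zero last component is a multiple of some \<open>lift X\<close>, and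
  all conditions involved are unchanged by non-zero scaling. Membership of the image in the quadric
  thus becomes vanishing of the pulled-back form.\<close>

lemma linfrac_invariant_quadric_iff:
  "linfrac_invariant A (quadric M) \<longleftrightarrow>
    (\<forall>v. qform M v = 0 \<longrightarrow> v $ None \<noteq> 0 \<longrightarrow> (A *v v) $ None \<noteq> 0 \<longrightarrow>
      qform (transpose A ** M ** A) v = 0)"
  (is "?L \<longleftrightarrow> ?R")
proof -
  have L: "?L \<longleftrightarrow> (\<forall>X. qform M (lift X) = 0 \<longrightarrow> (A *v lift X) $ None \<noteq> 0 \<longrightarrow>
      qform M (A *v lift X) = 0)"
    unfolding linfrac_invariant_def image_subset_iff Ball_def
    by (simp add: forbidden_def proj_last_def linfrac_def mem_quadric_iff lift_dehomog qform_scaleR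
        cong: imp_cong) blast
  show ?thesis
  proof
    assume ?R
    then show ?L
      by (simp add: L qform_congruence)
  next
    assume ?L
    then have *: "qform M (A *v lift X) = 0"
      if "qform M (lift X) = 0" "(A *v lift X) $ None \<noteq> 0" for X
      using that L by blast
    show ?R
    proof (intro allI impI)
      fix v
      assume "qform M v = 0" "v $ None \<noteq> 0" "(A *v v) $ None \<noteq> 0"
      with *[of "dehomog v"] show "qform (transpose A ** M ** A) v = 0"
        by (simp add: lift_dehomog qform_congruence qform_scaleR matrix_vector_mult_scaleR)
    qed
  qed
qed

lemma qform_scaleR_matrix: "qform (c *\<^sub>R M) x = c * qform M x"
  by (simp add: qform_def scaleR_matrix_vector_assoc[symmetric])

lemma invertible_row_nonzero:
  fixes A :: "real ^ 'k::finite ^ 'k"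
  assumes "invertible A"
  shows "row i A \<noteq> 0"
proof
  assume "row i A = 0"
  then have "det A = 0"
    by (rule det_zero_row)
  then show False
    using assms invertible_det_nz by blast
qed

theorem proposition4:
  fixes A M :: "real ^ 'n::finite option ^ 'n option"
  assumes "CARD('n) \<ge> 2"
    and "invertible A"
    and "symmetric_matrix M"
    and "indefinite M"
    and "rank M > 2"
  shows "linfrac_invariant A (quadric M) \<longleftrightarrow>
    (\<exists>\<mu>::real. \<mu> \<noteq> 0 \<and> transpose A ** M ** A = \<mu> *\<^sub>R M)"
proof
  let ?N = "transpose A ** M ** A"
  \<comment> \<open>Normals of the two excluded hyperplanes: infinity, and the vectors that
    \<open>A\<close> sends to infinity.\<close>
  have None_inner: "axis None 1 \<bullet> v = v $ None" "row None A \<bullet> v = (A *v v) $ None"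
    for v :: "real ^ 'n option"
    by (simp_all add: inner_axis' matrix_vector_mul_component row_def)
  assume inv: "linfrac_invariant A (quadric M)"
  then have "qform ?N v = 0"
    if "qform M v = 0" "axis None 1 \<bullet> v \<noteq> 0" "row None A \<bullet> v \<noteq> 0" for v
    using that by (simp add: linfrac_invariant_quadric_iff None_inner)
  moreover have "axis None 1 \<noteq> (0 :: real ^ 'n option)"
    by (simp add: axis_eq_0_iff)
  ultimately obtain \<mu> where \<mu>: "qform ?N x = \<mu> * qform M x" for x
    using qform_proportional[OF assms(3-5), of "axis None 1" "row None A" ?N]
      invertible_row_nonzero[OF assms(2)] by blast
  have "symmetric_matrix ?N"
    using assms(3) by (simp add: symmetric_matrix_def matrix_transpose_mul matrix_mul_assoc)
  moreover have "symmetric_matrix (\<mu> *\<^sub>R M)"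
    using assms(3) by (simp add: symmetric_matrix_def transpose_scalar)
  ultimately have eq: "?N = \<mu> *\<^sub>R M"
    by (rule symmetric_matrix_eqI) (simp add: \<mu> qform_scaleR_matrix)
  \<comment> \<open>Otherwise the form of \<open>M\<close> would vanish on the range of
    \<open>A\<close>, which is the whole space, contradicting indefiniteness.\<close>
  have "\<mu> \<noteq> 0"
  proof
    assume "\<mu> = 0"
    obtain y where y: "y \<bullet> (M *v y) > 0"
      using assms(4) by (auto simp: indefinite_def)
    obtain x where "A *v x = y"
      using assms(2) by (metis invertible_right_inverse matrix_vector_mul_assoc matrix_vector_mul_lid)
    then have "qform M y = \<mu> * qform M x"
      using \<mu> qform_congruence by metis
    with y \<open>\<mu> = 0\<close> show False
      by (simp add: qform_def)
  qed
  with eq show "\<exists>\<mu>. \<mu> \<noteq> 0 \<and> ?N = \<mu> *\<^sub>R M"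
    by blast
next
  assume "\<exists>\<mu>. \<mu> \<noteq> 0 \<and> transpose A ** M ** A = \<mu> *\<^sub>R M"
  then show "linfrac_invariant A (quadric M)"
    by (auto simp: linfrac_invariant_quadric_iff qform_scaleR_matrix)
qed

end
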